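(* Let $q\in\mathbb{N}$ be fixed, and assume that $\langle M\rangle>0$ is fixed. Then $\lambda_{\max}$ and $\lambda_{\min}$ are asymptotically independent (under $\mathsf{P}_{\boldsymbol z}$) as $\langle N\rangle\to\infty$, with the marginal limiting laws given, for any $x\ge0$, by $$\mathsf{P}_{\boldsymbol z}(\gamma\lambda_{\max}\le x)\to G_{\max}(x):=e^{-\langle M\rangle(1-G_{1/q}(x))},$$ $$\mathsf{P}_{\boldsymbol z}(\gamma\lambda_{\min}>x)\to G^{c}_{\min}(x):=e^{-\langle M\rangle G_{1/q}(x)}.$$ Moreover, conditionally on the partition being non-empty, $$\mathsf{P}_{\boldsymbol z}(\gamma\lambda_{\max}\le x\mid\lambda_{\max}>0)\to\widetilde{G}_{\max}(x):=\frac{G_{\max}(x)-e^{-\langle M\rangle}}{1-e^{-\langle M\rangle}},$$ $$\mathsf{P}_{\boldsymbol z}(\gamma\lambda_{\min}>x\mid\lambda_{\min}<\infty)\to\widetilde{G}^{c}_{\min}(x):=\frac{G^{c}_{\min}(x)-e^{-\langle M\rangle}}{1-e^{-\langle M\rangle}}.$$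
   Context: $\mathbb{N}=\{1,2,\dots\}$, $\mathbb{N}^q=\{j^q: j\in\mathbb{N}\}$. $\check{\Lambda}^q$ is the set of all strict integer partitions into $q$-th powers, i.e. finite (possibly empty) sequences $\lambda_1>\lambda_2>\cdots$ of distinct elements of $\mathbb{N}^q$. For $\lambda\in\check\Lambda^q$, the weight $N_\lambda$ is the sum of its parts and the length $M_\lambda$ is the number of its parts; $\lambda_{\max}$ and $\lambda_{\min}$ are its largest and smallest parts, with the convention $\lambda_{\max}=0$, $\lambda_{\min}=\infty$ for the empty partition. For $\boldsymbol z=(z_1,z_2)$ with $0<z_1<1$, $z_2>0$, the Boltzmann distribution on $\check\Lambda^q$ is $\mathsf{P}_{\boldsymbol z}(\lambda)=z_1^{N_\lambda}z_2^{M_\lambda}/F(\boldsymbol z)$, where $F(\boldsymbol z)=\sum_{\lambda\in\check\Lambda^q}z_1^{N_\lambda}z_2^{M_\lambda}$; $\mathsf{E}_{\boldsymbol z}$ is the corresponding expectation. Given real hyper-parameters $\langle N\rangle,\langle M\rangle>0$, the parameter $\boldsymbol z$ is calibrated as the root of the equations $\mathsf{E}_{\boldsymbol z}(N_\lambda)=\langle N\rangle$, $\mathsf{E}_{\boldsymbol z}(M_\lambda)=\langle M\rangle$; with $\kappa:=\langle M\rangle^{q+1}/\langle N\rangle\to0$ it satisfies $z_1=\exp\bigl(-\frac{\langle M\rangle}{q\langle N\rangle}(1+O(\kappa^{1/q}))\bigr)$, $z_2=\frac{\kappa^{1/q}}{q^{1/q}\Gamma(1+1/q)}(1+O(\kappa^{1/q}))$.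 Notation: $\gamma:=-\log z_1$, so that $\gamma\sim\langle M\rangle/(q\langle N\rangle)$, and $G_\alpha(x)=\frac{1}{\Gamma(\alpha)}\int_0^x u^{\alpha-1}e^{-u}\,du$ for $x\ge0$ (distribution function of the gamma distribution with shape parameter $\alpha>0$ and unit scale).
   Formalization: Asymptotic independence is stated as factorisation of P(γλ_max ≤ x, γλ_min > y) in the limit only for 0 ≤ y ≤ x; for y > x ≥ 0 it fails, since the joint event is the empty partition, with limit e^{-⟨M⟩}, larger than the product of the marginal limits. *)

theory Defs
  imports "HOL-Probability.Probability"
begin

definition strict_power_partitions :: "nat \<Rightarrow> nat list set" where
  "strict_power_partitions q =
     {l. sorted_wrt (>) l \<and> set l \<subseteq> {j ^ q | j. 1 \<le> j}}"

abbreviation weight :: "nat list \<Rightarrow> nat" where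
  "weight l \<equiv> sum_list l"

definition part_max :: "nat list \<Rightarrow> nat" where
  "part_max l = (if l = [] then 0 else Max (set l))"

definition part_min :: "nat list \<Rightarrow> ereal" where
  "part_min l = (if l = [] then \<infinity> else ereal (real (Min (set l))))"

definition partition_fun :: "nat \<Rightarrow> real \<Rightarrow> real \<Rightarrow> real" where
  "partition_fun q z1 z2 =
     (\<Sum>\<^sub>\<infinity>l\<in>strict_power_partitions q. z1 ^ weight l * z2 ^ length l)"

definition boltzmann :: "nat \<Rightarrow> real \<Rightarrow> real \<Rightarrow> nat list measure" where
  "boltzmann q z1 z2 =
     point_measure (strict_power_partitions q)
       (\<lambda>l. ennreal (z1 ^ weight l * z2 ^ length l / partition_fun q z1 z2))"

definition calibrated :: "nat \<Rightarrow> real \<Rightarrow> real \<Rightarrow> real \<Rightarrow> real \<Rightarrow> bool" where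
  "calibrated q z1 z2 N M \<longleftrightarrow>
     0 < z1 \<and> z1 < 1 \<and> 0 < z2 \<and>
     (LINT l|boltzmann q z1 z2. real (weight l)) = N \<and>
     (LINT l|boltzmann q z1 z2. real (length l)) = M"

definition gamma_cdf :: "real \<Rightarrow> real \<Rightarrow> real" where
  "gamma_cdf \<alpha> x = integral {0..x} (\<lambda>u. u powr (\<alpha> - 1) * exp (- u)) / Gamma \<alpha>"

definition G_max :: "nat \<Rightarrow> real \<Rightarrow> real \<Rightarrow> real" where
  "G_max q M x = exp (- M * (1 - gamma_cdf (1 / real q) x))"

definition Gc_min :: "nat \<Rightarrow> real \<Rightarrow> real \<Rightarrow> real" where
  "Gc_min q M x = exp (- M * gamma_cdf (1 / real q) x)"

definition G_max_cond :: "nat \<Rightarrow> real \<Rightarrow> real \<Rightarrow> real" where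
  "G_max_cond q M x = (G_max q M x - exp (- M)) / (1 - exp (- M))"

definition Gc_min_cond :: "nat \<Rightarrow> real \<Rightarrow> real \<Rightarrow> real" where
  "Gc_min_cond q M x = (Gc_min q M x - exp (- M)) / (1 - exp (- M))"

text \<open>
  Asymptotic independence of the largest and the smallest part, both rescaled by \<open>\<gamma>\<close>: the joint
  probability of \<open>\<gamma> \<lambda>\<^sub>m\<^sub>a\<^sub>x \<le> x\<close> and \<open>\<gamma> \<lambda>\<^sub>m\<^sub>i\<^sub>n > y\<close> is asymptotically the product of the two
  probabilities.  The thresholds are restricted to \<open>0 \<le> y \<le> x\<close>.  For \<open>y > x\<close> the two events occur
  together only on the empty partition (where the maximum is \<open>0\<close> and the minimum is \<open>\<infinity>\<close>), whose
  probability has the positive limit \<open>exp (- M)\<close> when the expected length is kept at \<open>M\<close>; the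
  product of the marginal limits is then \<open>exp (- M * (1 + G y - G x))\<close>, with \<open>G\<close> the gamma
  distribution function, so that factorisation fails for every \<open>y > x\<close>.
\<close>

definition asymp_indep_max_min ::
    "('b \<Rightarrow> nat list measure) \<Rightarrow> ('b \<Rightarrow> real) \<Rightarrow> 'b filter \<Rightarrow> bool" where
  "asymp_indep_max_min P \<gamma> F \<longleftrightarrow>
     (\<forall>x y. 0 \<le> y \<and> y \<le> x \<longrightarrow>
       ((\<lambda>t. \<P>(l in P t. \<gamma> t * real (part_max l) \<le> x \<and> ereal y < ereal (\<gamma> t) * part_min l)
           - \<P>(l in P t. \<gamma> t * real (part_max l) \<le> x)
             * \<P>(l in P t. ereal y < ereal (\<gamma> t) * part_min l)) \<longlongrightarrow> 0) F)"

end

theory Submission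
  imports Defs
begin

text \<open>
  Write \<open>w j = z2 * z1 ^ (j + 1) ^ q\<close>. Under the Boltzmann law the parts \<open>(j + 1) ^ q\<close> occur
  independently with probabilities \<open>w j / (1 + w j)\<close>, so the event that all parts have indices in \<open>A\<close>
  has probability \<open>exp (- (\<Sum>j\<notin>A. ln (1 + w j)))\<close>. All events in question are of this form, and for
  \<open>y \<le> x\<close> the joint law of maximum and minimum factorises exactly. It remains to find the limits of
  the exponents. Calibration forces \<open>\<gamma> \<rightarrow> 0\<close>, since otherwise the expected weight
  stays bounded. With \<open>d = \<gamma> powr (1 / q)\<close> one has \<open>w j = z2 * exp (- (d * (j + 1)) ^ q)\<close>, so that
  \<open>d / z2\<close> times a sum of the \<open>w j\<close> is a Riemann sum for the integral of \<open>exp (- t ^ q)\<close>,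
  with error \<open>O(d)\<close> by monotonicity. Hence \<open>z2 \<rightarrow> 0\<close>, the logarithms may be replaced
  by the \<open>w j\<close>, whose total tends to \<open>M\<close>, and the substitution \<open>u = t ^ q\<close> turns the partial
  integrals into the gamma distribution function.
\<close>

section \<open>Weights of sets of partitions\<close>

text \<open>Indices start at 0, so \<open>j\<close> stands for the part \<open>Suc j ^ q\<close> and
  series run over all of \<open>nat\<close>.\<close>

definition part_wt :: "nat \<Rightarrow> real \<Rightarrow> real \<Rightarrow> nat \<Rightarrow> real" where
  "part_wt q z1 z2 j = z2 * z1 ^ (Suc j ^ q)"

text \<open>Events are described by sets of indices rather than of parts, so that intersections and
  complements can be taken on subsets of \<open>nat\<close>.\<close>

definition parts_in :: "nat \<Rightarrow> nat set \<Rightarrow> nat list set" where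
  "parts_in q A = {l. sorted_wrt (>) l \<and> set l \<subseteq> (\<lambda>j. Suc j ^ q) ` A}"

lemma strict_power_partitions_eq: "strict_power_partitions q = parts_in q UNIV"
proof -
  have "{j ^ q | j. 1 \<le> j} = range (\<lambda>j. Suc j ^ q)"
    by (auto simp: image_iff) (metis One_nat_def Suc_pred' less_eq_Suc_le)
  thus ?thesis by (auto simp: strict_power_partitions_def parts_in_def)
qed

lemma parts_in_subset: "parts_in q A \<subseteq> strict_power_partitions q"
  by (auto simp: strict_power_partitions_eq parts_in_def)

lemma inj_power_Suc: "q \<ge> 1 \<Longrightarrow> inj_on (\<lambda>j. Suc j ^ q) A"
  by (auto simp: inj_on_def power_eq_iff_eq_base)

text \<open>A strictly decreasing list is recovered from its set of entries by sorting and
  reversing. This turns sums over partitions into sums over subsets.\<close>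

lemma bij_betw_set_strict_decreasing:
  fixes B :: "'a :: linorder set"
  assumes "finite B"
  shows "bij_betw set {l. sorted_wrt (>) l \<and> set l \<subseteq> B} (Pow B)"
proof (rule bij_betw_byWitness[where f' = "\<lambda>S. rev (sorted_list_of_set S)"])
  have rev_eq: "sorted_wrt (>) (rev l) \<longleftrightarrow> sorted_wrt (<) l" for l :: "'a list"
    by (simp add: sorted_wrt_rev)
  show "\<forall>l\<in>{l. sorted_wrt (>) l \<and> set l \<subseteq> B}. rev (sorted_list_of_set (set l)) = l"
  proof
    fix l assume "l \<in> {l. sorted_wrt (>) l \<and> set l \<subseteq> B}"
    hence "sorted_wrt (<) (rev l)" using rev_eq[of "rev l"] by simp
    hence "sorted_list_of_set (set (rev l)) = rev l"
      using sorted_list_of_set.idem_if_sorted_distinct strict_sorted_iff by blast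
    thus "rev (sorted_list_of_set (set l)) = l" by simp
  qed
  show "\<forall>S\<in>Pow B. set (rev (sorted_list_of_set S)) = S"
    using assms by (auto dest: finite_subset)
  show "set ` {l. sorted_wrt (>) l \<and> set l \<subseteq> B} \<subseteq> Pow B" by auto
  show "(\<lambda>S. rev (sorted_list_of_set S)) ` Pow B \<subseteq> {l. sorted_wrt (>) l \<and> set l \<subseteq> B}"
  proof
    fix l assume "l \<in> (\<lambda>S. rev (sorted_list_of_set S)) ` Pow B"
    then obtain S where S: "S \<subseteq> B" "l = rev (sorted_list_of_set S)" by auto
    moreover have "finite S" using S assms finite_subset by blast
    ultimately show "l \<in> {l. sorted_wrt (>) l \<and> set l \<subseteq> B}" by (simp add: rev_eq)
  qed
qed

lemma finite_parts_in: "finite A \<Longrightarrow> finite (parts_in q A)"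
  unfolding parts_in_def
  using bij_betw_finite[OF bij_betw_set_strict_decreasing, of "(\<lambda>j. Suc j ^ q) ` A"] by simp

lemma boltzmann_weight_eq_prod:
  assumes "sorted_wrt (>) l"
  shows "(z1::real) ^ weight l * z2 ^ length l = (\<Prod>b\<in>set l. z2 * z1 ^ b)"
  using assms by (induction l) (auto simp: power_add)

text \<open>Expanding the product gives one term for each subset of the admissible parts, hence one
  for each strict partition.\<close>

lemma sum_parts_in:
  assumes "q \<ge> 1" "finite A"
  shows "(\<Sum>l\<in>parts_in q A. z1 ^ weight l * z2 ^ length l) = (\<Prod>j\<in>A. 1 + part_wt q z1 z2 j)"
proof -
  let ?B = "(\<lambda>j. Suc j ^ q) ` A"
  have "(\<Sum>l\<in>parts_in q A. z1 ^ weight l * z2 ^ length l)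
      = (\<Sum>l\<in>parts_in q A. \<Prod>b\<in>set l. z2 * z1 ^ b)"
    by (intro sum.cong refl boltzmann_weight_eq_prod) (auto simp: parts_in_def)
  also have "\<dots> = (\<Sum>S\<in>Pow ?B. \<Prod>b\<in>S. z2 * z1 ^ b)"
    unfolding parts_in_def
    using assms by (intro sum.reindex_bij_betw bij_betw_set_strict_decreasing) auto
  also have "\<dots> = (\<Prod>b\<in>?B. z2 * z1 ^ b + 1)"
    using assms by (subst prod_add) auto
  also have "\<dots> = (\<Prod>j\<in>A. 1 + part_wt q z1 z2 j)"
    using assms by (subst prod.reindex) (auto simp: inj_power_Suc part_wt_def add.commute)
  finally show ?thesis .
qed

lemma part_wt_pos: "0 < z1 \<Longrightarrow> 0 < z2 \<Longrightarrow> 0 < part_wt q z1 z2 j"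
  by (simp add: part_wt_def)

lemma summable_part_wt:
  assumes "q \<ge> 1" "0 < z1" "z1 < 1" "0 < z2"
  shows "summable (part_wt q z1 z2)"
proof (rule summable_comparison_test')
  show "summable (\<lambda>j. z2 * z1 ^ j)"
    using assms by (intro summable_mult summable_geometric) auto
  fix j :: nat
  have "j \<le> Suc j ^ q"
    using assms self_le_power[of "Suc j" q] by simp
  thus "norm (part_wt q z1 z2 j) \<le> z2 * z1 ^ j"
    using assms by (simp add: part_wt_def power_decreasing)
qed

lemma ln_part_wt_nonneg: "0 < z1 \<Longrightarrow> 0 < z2 \<Longrightarrow> 0 \<le> ln (1 + part_wt q z1 z2 j)"
  using part_wt_pos[of z1 z2 q j] by simp

lemma ln_part_wt_le: "0 < z1 \<Longrightarrow> 0 < z2 \<Longrightarrow> ln (1 + part_wt q z1 z2 j) \<le> part_wt q z1 z2 j"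
  using part_wt_pos[of z1 z2 q j] by (simp add: ln_add_one_self_le_self)

lemma summable_ln_part_wt:
  assumes "q \<ge> 1" "0 < z1" "z1 < 1" "0 < z2"
  shows "summable (\<lambda>j. ln (1 + part_wt q z1 z2 j))"
  using assms
  by (intro summable_comparison_test'[OF summable_part_wt[OF assms], of 0])
     (simp add: ln_part_wt_nonneg ln_part_wt_le)

lemma summable_indicator_mult:
  fixes f :: "nat \<Rightarrow> real"
  assumes "summable f" "\<And>j. 0 \<le> f j"
  shows "summable (\<lambda>j. indicator A j * f j)"
  using assms by (intro summable_comparison_test'[OF assms(1), of 0]) (auto simp: indicator_def)

text \<open>The logarithm of the generating function of the partitions with indices in
  \<open>A\<close>. Products over disjoint index sets become sums, and the indicator allows infinite
  \<open>A\<close>.\<close>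

definition log_partition_sum :: "nat \<Rightarrow> real \<Rightarrow> real \<Rightarrow> nat set \<Rightarrow> real" where
  "log_partition_sum q z1 z2 A = (\<Sum>j. indicator A j * ln (1 + part_wt q z1 z2 j))"

lemma summable_log_partition:
  assumes "q \<ge> 1" "0 < z1" "z1 < 1" "0 < z2"
  shows "summable (\<lambda>j. indicator A j * ln (1 + part_wt q z1 z2 j))"
  using assms by (intro summable_indicator_mult summable_ln_part_wt ln_part_wt_nonneg)

lemma log_partition_sum_Un:
  assumes "q \<ge> 1" "0 < z1" "z1 < 1" "0 < z2" "A \<inter> B = {}"
  shows "log_partition_sum q z1 z2 (A \<union> B)
      = log_partition_sum q z1 z2 A + log_partition_sum q z1 z2 B"
  unfolding log_partition_sum_def using assms
  by (simp add: suminf_add summable_log_partition indicator_add[symmetric] distrib_right)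

text \<open>The infinite product arises from the finite ones by continuity of measure from below.
  Working in \<open>ennreal\<close> avoids presupposing that the partition function is
  finite.\<close>

lemma emeasure_unnormalized_parts_in:
  assumes "q \<ge> 1" "0 < z1" "z1 < 1" "0 < z2"
  shows "emeasure (point_measure (strict_power_partitions q)
      (\<lambda>l. ennreal (z1 ^ weight l * z2 ^ length l)))
           (parts_in q A) = ennreal (exp (log_partition_sum q z1 z2 A))" (is "emeasure ?U _ = _")
proof -
  have fin: "emeasure ?U (parts_in q (A \<inter> {..<n}))
      = ennreal (exp (\<Sum>j<n. indicator A j * ln (1 + part_wt q z1 z2 j)))" for n
  proof -
    have "emeasure ?U (parts_in q (A \<inter> {..<n}))
        = (\<Sum>l\<in>parts_in q (A \<inter> {..<n}). ennreal (z1 ^ weight l * z2 ^ length l))"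
      by (intro emeasure_point_measure_finite2 parts_in_subset finite_parts_in) auto
    also have "\<dots> = ennreal (\<Prod>j\<in>A \<inter> {..<n}. 1 + part_wt q z1 z2 j)"
      using assms by (subst sum_ennreal) (simp_all add: sum_parts_in)
    also have "(\<Prod>j\<in>A \<inter> {..<n}. 1 + part_wt q z1 z2 j)
        = (\<Prod>j\<in>A \<inter> {..<n}. exp (ln (1 + part_wt q z1 z2 j)))"
      by (intro prod.cong) (use part_wt_pos[of z1 z2 q] assms in \<open>auto simp: add_pos_pos\<close>)
    also have "\<dots> = exp (\<Sum>j\<in>A \<inter> {..<n}. ln (1 + part_wt q z1 z2 j))"
      by (simp add: exp_sum)
    also have "(\<Sum>j\<in>A \<inter> {..<n}. ln (1 + part_wt q z1 z2 j))
        = (\<Sum>j<n. indicator A j * ln (1 + part_wt q z1 z2 j))"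
      by (simp add: sum.inter_restrict Int_commute indicator_def if_distrib[of "\<lambda>a. a * _"]
          cong: if_cong)
    finally show ?thesis .
  qed
  have inc: "incseq (\<lambda>n. parts_in q (A \<inter> {..<n}))"
    by (auto simp: incseq_def parts_in_def)
  \<comment> \<open>A partition has finitely many parts, so all its indices lie below some
    \<open>n\<close>.\<close>
  have Un: "(\<Union>n. parts_in q (A \<inter> {..<n})) = parts_in q A"
  proof (intro equalityI subsetI)
    fix l assume l: "l \<in> parts_in q A"
    hence "set l \<subseteq> (\<lambda>j. Suc j ^ q) ` A" by (simp add: parts_in_def)
    hence "\<exists>J\<subseteq>A. finite J \<and> set l = (\<lambda>j. Suc j ^ q) ` J"
      by (intro finite_subset_image finite_set)
    then obtain J where J: "J \<subseteq> A" "finite J" and set_l: "set l = (\<lambda>j. Suc j ^ q) ` J"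
      by (elim exE conjE) (rule that)
    obtain n where n: "J \<subseteq> {..<n}"
      using finite_nat_iff_bounded[THEN iffD1, OF J(2)] by (elim exE) (rule that)
    have "set l \<subseteq> (\<lambda>j. Suc j ^ q) ` (A \<inter> {..<n})"
      unfolding set_l using J(1) n by (intro image_mono Int_greatest)
    hence "l \<in> parts_in q (A \<inter> {..<n})" using l by (simp add: parts_in_def)
    thus "l \<in> (\<Union>n. parts_in q (A \<inter> {..<n}))" by blast
  qed (auto simp: parts_in_def)
  have "(\<lambda>n. emeasure ?U (parts_in q (A \<inter> {..<n}))) \<longlonglongrightarrow> emeasure ?U (parts_in q A)"
    using Lim_emeasure_incseq[OF _ inc, of ?U] parts_in_subset
    by (auto simp: Un sets_point_measure)
  moreover have "(\<lambda>n. emeasure ?U (parts_in q (A \<inter> {..<n})))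
      \<longlonglongrightarrow> ennreal (exp (log_partition_sum q z1 z2 A))"
    unfolding fin log_partition_sum_def
    by (intro tendsto_ennrealI tendsto_exp summable_LIMSEQ summable_log_partition assms)
  ultimately show ?thesis using LIMSEQ_unique by blast
qed

text \<open>\<open>infsum\<close> defaults to 0 for families that are not summable. The finite total
  mass just computed gives integrability over the counting measure, which excludes this
  case.\<close>

lemma partition_fun_eq:
  assumes "q \<ge> 1" "0 < z1" "z1 < 1" "0 < z2"
  shows "partition_fun q z1 z2 = exp (log_partition_sum q z1 z2 UNIV)"
proof -
  let ?L = "strict_power_partitions q" and ?f = "\<lambda>l. z1 ^ weight l * z2 ^ length l"
  have nn: "(\<integral>\<^sup>+l. ennreal (?f l) \<partial>count_space ?L) = ennreal (exp (log_partition_sum q z1 z2 UNIV))"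
    using emeasure_unnormalized_parts_in[OF assms, of UNIV]
    unfolding point_measure_def
    by (subst (asm) emeasure_density)
       (auto simp flip: strict_power_partitions_eq intro: nn_integral_cong elim!: trans[rotated])
  have int: "integrable (count_space ?L) ?f"
    using assms nn by (simp add: integrable_iff_bounded)
  hence "infsum ?f ?L = (LINT l|count_space ?L. ?f l)"
    using infsetsum_infsum[of ?f ?L] by (simp add: abs_summable_on_def infsetsum_def)
  moreover have "ennreal (LINT l|count_space ?L. ?f l)
      = ennreal (exp (log_partition_sum q z1 z2 UNIV))"
    using nn_integral_eq_integral[OF int] assms nn by simp
  ultimately show ?thesis
    using assms by (simp add: partition_fun_def)
qed

section \<open>Normalisation to a probability measure\<close>

lemma emeasure_boltzmann:
  assumes "E \<subseteq> strict_power_partitions q" "0 < z1" "0 < z2"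
  shows "emeasure (boltzmann q z1 z2) E = ennreal (1 / partition_fun q z1 z2) *
    emeasure (point_measure (strict_power_partitions q)
      (\<lambda>l. ennreal (z1 ^ weight l * z2 ^ length l))) E"
proof -
  have "ennreal (z1 ^ weight l * z2 ^ length l / partition_fun q z1 z2)
      = ennreal (1 / partition_fun q z1 z2) * ennreal (z1 ^ weight l * z2 ^ length l)" for l
    using assms by (subst ennreal_mult''[symmetric]) auto
  thus ?thesis
    using assms(1) unfolding boltzmann_def point_measure_def
    by (simp add: emeasure_density nn_integral_cmult mult.assoc)
qed

text \<open>Dividing by the full generating function cancels the factors with index in
  \<open>A\<close> and leaves the reciprocals of those outside \<open>A\<close>.\<close>

lemma emeasure_boltzmann_parts_in:
  assumes "q \<ge> 1" "0 < z1" "z1 < 1" "0 < z2"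
  shows "emeasure (boltzmann q z1 z2) (parts_in q A)
      = ennreal (exp (- log_partition_sum q z1 z2 (- A)))"
proof -
  have "log_partition_sum q z1 z2 UNIV
      = log_partition_sum q z1 z2 A + log_partition_sum q z1 z2 (- A)"
    using log_partition_sum_Un[OF assms, of A "- A"] by simp
  thus ?thesis
    using assms by (simp add: emeasure_boltzmann parts_in_subset emeasure_unnormalized_parts_in
        partition_fun_eq exp_add exp_minus field_simps flip: ennreal_mult)
qed

lemma space_boltzmann: "space (boltzmann q z1 z2) = strict_power_partitions q"
  by (simp add: boltzmann_def space_point_measure)

lemma sets_boltzmann: "sets (boltzmann q z1 z2) = Pow (strict_power_partitions q)"
  by (simp add: boltzmann_def sets_point_measure)

lemma prob_space_boltzmann:
  assumes "q \<ge> 1" "0 < z1" "z1 < 1" "0 < z2"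
  shows "prob_space (boltzmann q z1 z2)"
proof
  show "emeasure (boltzmann q z1 z2) (space (boltzmann q z1 z2)) = 1"
    using emeasure_boltzmann_parts_in[OF assms, of UNIV]
    by (simp add: space_boltzmann strict_power_partitions_eq log_partition_sum_def)
qed

lemma measure_boltzmann_parts_in:
  assumes "q \<ge> 1" "0 < z1" "z1 < 1" "0 < z2"
  shows "measure (boltzmann q z1 z2) (parts_in q A) = exp (- log_partition_sum q z1 z2 (- A))"
  using emeasure_boltzmann_parts_in[OF assms] by (simp add: measure_def)

section \<open>Events and expectations under the Boltzmann law\<close>

lemma parts_in_Int:
  assumes "q \<ge> 1"
  shows "parts_in q (A \<inter> B) = parts_in q A \<inter> parts_in q B"
proof -
  have "{l. P l \<and> set l \<subseteq> X \<inter> Y} = {l. P l \<and> set l \<subseteq> X} \<inter> {l. P l \<and> set l \<subseteq> Y}"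
    for P :: "nat list \<Rightarrow> bool" and X Y by auto
  thus ?thesis
    unfolding parts_in_def inj_on_image_Int[OF inj_power_Suc[OF assms] subset_UNIV subset_UNIV] .
qed

lemma parts_in_empty: "parts_in q {} = {[]}"
  by (auto simp: parts_in_def)

text \<open>Any event that constrains each part separately is thereby an index-set event.\<close>

lemma ball_parts_iff:
  "{l \<in> strict_power_partitions q. \<forall>b\<in>set l. R b} = parts_in q {j. R (Suc j ^ q)}"
proof -
  have "{l \<in> {l. P l \<and> set l \<subseteq> range f}. \<forall>b\<in>set l. R b} = {l. P l \<and> set l \<subseteq> f ` {j. R (f j)}}"
    for P and f :: "nat \<Rightarrow> nat" by auto
  thus ?thesis unfolding strict_power_partitions_eq parts_in_def .
qed

text \<open>The empty partition has maximum 0, so \<open>0 \<le> x\<close> places it in the event,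
  in agreement with the right-hand side.\<close>

lemma part_max_event:
  assumes "0 < g" "0 \<le> x"
  shows "{l \<in> strict_power_partitions q. g * real (part_max l) \<le> x}
      = parts_in q {j. g * real (Suc j ^ q) \<le> x}"
proof -
  have "g * real (part_max l) \<le> x \<longleftrightarrow> (\<forall>b\<in>set l. g * real b \<le> x)" for l
  proof (cases "l = []")
    case False
    have "g * real b \<le> g * real (Max (set l))" if "b \<in> set l" for b
      using that assms by (intro mult_left_mono) simp_all
    moreover have "Max (set l) \<in> set l" using False by simp
    ultimately show ?thesis
      unfolding part_max_def if_not_P[OF False] by (meson order.trans)
  qed (use assms in \<open>simp add: part_max_def\<close>)
  thus ?thesis by (simp only: ball_parts_iff)
qed

text \<open>The empty partition has infinite minimum and lies in the event for every real
  \<open>y\<close>.\<close>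

lemma part_min_event:
  assumes "0 < g"
  shows "{l \<in> strict_power_partitions q. ereal y < ereal g * part_min l}
      = parts_in q {j. y < g * real (Suc j ^ q)}"
proof -
  have "ereal y < ereal g * part_min l \<longleftrightarrow> (\<forall>b\<in>set l. y < g * real b)" for l
  proof (cases "l = []")
    case False
    have "g * real (Min (set l)) \<le> g * real b" if "b \<in> set l" for b
      using that assms by (intro mult_left_mono) simp_all
    moreover have "Min (set l) \<in> set l" using False by simp
    ultimately have "y < g * real (Min (set l)) \<longleftrightarrow> (\<forall>b\<in>set l. y < g * real b)"
      by (meson order.strict_trans2)
    thus ?thesis by (simp add: part_min_def False)
  qed (use assms in \<open>simp add: part_min_def\<close>)
  thus ?thesis by (simp only: ball_parts_iff)
qed

section \<open>Occupation probabilities and expectations of additive functionals\<close>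

lemma emeasure_boltzmann_part:
  assumes "q \<ge> 1" "0 < z1" "z1 < 1" "0 < z2"
  shows "emeasure (boltzmann q z1 z2) {l \<in> strict_power_partitions q. Suc j ^ q \<in> set l}
    = ennreal (part_wt q z1 z2 j / (1 + part_wt q z1 z2 j))"
proof -
  interpret prob_space "boltzmann q z1 z2" by (rule prob_space_boltzmann[OF assms])
  have w: "0 < part_wt q z1 z2 j" using assms part_wt_pos by blast
  have "log_partition_sum q z1 z2 {j} = ln (1 + part_wt q z1 z2 j)"
    unfolding log_partition_sum_def
    using sums_If_finite_set[of "{j}" "\<lambda>j. ln (1 + part_wt q z1 z2 j)"]
    by (intro sums_unique[symmetric]) (simp add: indicator_def of_bool_def if_distrib[of "\<lambda>a. a * _"]
        cong: if_cong)
  \<comment> \<open>Complement of the event that excludes the index \<open>j\<close> alone, which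
    has probability \<open>1 / (1 + w)\<close> for the weight \<open>w\<close> of
    \<open>j\<close>.\<close>
  moreover have "{l \<in> strict_power_partitions q. Suc j ^ q \<in> set l}
      = space (boltzmann q z1 z2) - parts_in q (- {j})"
  proof -
    have "{l \<in> strict_power_partitions q. \<forall>b\<in>set l. b \<noteq> Suc j ^ q} = parts_in q (- {j})"
      using ball_parts_iff[of q "\<lambda>b. b \<noteq> Suc j ^ q"]
        inj_eq[OF inj_power_Suc[OF assms(1)], of _ j] by (simp only: Compl_eq singleton_iff)
    thus ?thesis unfolding space_boltzmann by blast
  qed
  ultimately have "measure (boltzmann q z1 z2) {l \<in> strict_power_partitions q. Suc j ^ q \<in> set l}
      = 1 - exp (- ln (1 + part_wt q z1 z2 j))"
    using assms by (simp add: prob_compl sets_boltzmann parts_in_subset measure_boltzmann_parts_in)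
  also have "\<dots> = part_wt q z1 z2 j / (1 + part_wt q z1 z2 j)"
    using w by (simp add: exp_minus field_simps)
  finally show ?thesis by (simp add: emeasure_eq_measure)
qed

text \<open>Writing an additive functional as a series of indicators prepares termwise integration.
  Only the finitely many indices of parts of \<open>l\<close> contribute.\<close>

lemma suminf_indicator_parts:
  fixes h :: "nat \<Rightarrow> real"
  assumes "q \<ge> 1" "l \<in> strict_power_partitions q" "\<And>b. 0 \<le> h b"
  shows "(\<Sum>j. ennreal (h (Suc j ^ q))
        * indicator {l \<in> strict_power_partitions q. Suc j ^ q \<in> set l} l)
    = ennreal (\<Sum>b\<in>set l. h b)"
proof -
  have "set l \<subseteq> range (\<lambda>j. Suc j ^ q)"
    using assms(2) by (simp add: strict_power_partitions_eq parts_in_def)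
  hence "\<exists>J\<subseteq>UNIV. finite J \<and> set l = (\<lambda>j. Suc j ^ q) ` J"
    by (intro finite_subset_image finite_set)
  then obtain J where J: "finite J" "set l = (\<lambda>j. Suc j ^ q) ` J"
    by (elim exE conjE) (rule that)
  have iff: "Suc j ^ q \<in> set l \<longleftrightarrow> j \<in> J" for j
    unfolding J(2) by (rule inj_image_mem_iff[OF inj_power_Suc[OF assms(1)]])
  have "(\<Sum>j. ennreal (h (Suc j ^ q))
        * indicator {l \<in> strict_power_partitions q. Suc j ^ q \<in> set l} l)
      = (\<Sum>j\<in>J. ennreal (h (Suc j ^ q))
        * indicator {l \<in> strict_power_partitions q. Suc j ^ q \<in> set l} l)"
    using J(1) by (intro suminf_finite) (auto simp: iff)
  also have "\<dots> = (\<Sum>j\<in>J. ennreal (h (Suc j ^ q)))"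
    using assms(2) by (intro sum.cong) (auto simp: iff)
  also have "\<dots> = ennreal (\<Sum>b\<in>set l. h b)"
    unfolding J(2) by (subst sum.reindex[OF inj_power_Suc[OF assms(1)]]) (simp add: assms(3))
  finally show ?thesis .
qed

text \<open>Linearity of expectation, carried out with the nonnegative integral, where exchanging
  sum and integral needs no convergence.\<close>

lemma boltzmann_expectation_sums:
  fixes h :: "nat \<Rightarrow> real"
  assumes "q \<ge> 1" "0 < z1" "z1 < 1" "0 < z2" "\<And>b. 0 \<le> h b"
    and "(LINT l|boltzmann q z1 z2. (\<Sum>b\<in>set l. h b)) = c" "c > 0"
  shows "(\<lambda>j. h (Suc j ^ q) * (part_wt q z1 z2 j / (1 + part_wt q z1 z2 j))) sums c"
proof -
  let ?p = "\<lambda>j. part_wt q z1 z2 j / (1 + part_wt q z1 z2 j)" and ?B = "boltzmann q z1 z2"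
  have p: "0 \<le> ?p j" for j using part_wt_pos[of z1 z2 q j] assms by simp
  have hp: "0 \<le> h (Suc j ^ q) * ?p j" for j by (intro mult_nonneg_nonneg assms(5) p)
  have meas: "f \<in> borel_measurable ?B" for f :: "nat list \<Rightarrow> 'x :: topological_space"
    by (simp add: boltzmann_def)
  have "(\<integral>\<^sup>+l. ennreal (\<Sum>b\<in>set l. h b) \<partial>?B)
      = (\<integral>\<^sup>+l. (\<Sum>j. ennreal (h (Suc j ^ q))
        * indicator {l \<in> strict_power_partitions q. Suc j ^ q \<in> set l} l) \<partial>?B)"
    by (intro nn_integral_cong suminf_indicator_parts[symmetric] assms) (simp add: space_boltzmann)
  also have "\<dots> = (\<Sum>j. ennreal (h (Suc j ^ q))
        * emeasure ?B {l \<in> strict_power_partitions q. Suc j ^ q \<in> set l})"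
    by (subst nn_integral_suminf[OF meas], subst nn_integral_cmult_indicator)
       (auto simp: sets_boltzmann)
  also have "\<dots> = (\<Sum>j. ennreal (h (Suc j ^ q) * ?p j))"
    using assms p by (intro suminf_cong) (simp only: emeasure_boltzmann_part ennreal_mult)
  finally have eq: "(\<integral>\<^sup>+l. ennreal (\<Sum>b\<in>set l. h b) \<partial>?B) = (\<Sum>j. ennreal (h (Suc j ^ q) * ?p j))" .
  have "c = enn2real (\<integral>\<^sup>+l. ennreal (\<Sum>b\<in>set l. h b) \<partial>?B)"
    unfolding assms(6)[symmetric]
    by (intro integral_eq_nn_integral meas) (simp add: assms(5) sum_nonneg)
  hence c: "c = enn2real (\<Sum>j. ennreal (h (Suc j ^ q) * ?p j))" unfolding eq .
  \<comment> \<open>\<open>enn2real\<close> sends \<open>top\<close> to 0, so a positive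
    \<open>c\<close> certifies that the expectation is a genuine finite value and not a
    default.\<close>
  hence "(\<Sum>j. ennreal (h (Suc j ^ q) * ?p j)) \<noteq> top" using \<open>c > 0\<close> by auto
  hence s: "summable (\<lambda>j. h (Suc j ^ q) * ?p j)"
    by (intro summable_suminf_not_top hp)
  hence "c = (\<Sum>j. h (Suc j ^ q) * ?p j)"
    unfolding c by (simp only: suminf_ennreal2[OF hp s] enn2real_ennreal[OF suminf_nonneg[OF s hp]])
  thus ?thesis using s summable_sums by blast
qed

text \<open>Parts are distinct, so length and weight are the additive functionals with
  \<open>h b = 1\<close> and \<open>h b = b\<close>.\<close>

lemma calibrated_sums:
  assumes "q \<ge> 1" "calibrated q z1 z2 N M" "0 < N" "0 < M"
  shows "(\<lambda>j. part_wt q z1 z2 j / (1 + part_wt q z1 z2 j)) sums M"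
    and "(\<lambda>j. real (Suc j ^ q) * (part_wt q z1 z2 j / (1 + part_wt q z1 z2 j))) sums N"
proof -
  have z: "0 < z1" "z1 < 1" "0 < z2" using assms(2) by (auto simp: calibrated_def)
  have dist: "distinct l" if "l \<in> space (boltzmann q z1 z2)" for l
    using that strict_sorted_iff[of "rev l"]
    by (simp add: space_boltzmann strict_power_partitions_def sorted_wrt_rev)
  have "(LINT l|boltzmann q z1 z2. (\<Sum>b\<in>set l. 1)) = (LINT l|boltzmann q z1 z2. real (length l))"
    by (intro Bochner_Integration.integral_cong refl) (simp add: dist distinct_card)
  hence M: "(LINT l|boltzmann q z1 z2. (\<Sum>b\<in>set l. 1)) = M"
    using assms(2) by (simp add: calibrated_def)
  have "real (weight l) = (\<Sum>b\<in>set l. real b)" if "distinct l" for l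
    using that by (induction l) auto
  hence "(LINT l|boltzmann q z1 z2. (\<Sum>b\<in>set l. real b))
      = (LINT l|boltzmann q z1 z2. real (weight l))"
    by (intro Bochner_Integration.integral_cong refl) (simp add: dist)
  hence N: "(LINT l|boltzmann q z1 z2. (\<Sum>b\<in>set l. real b)) = N"
    using assms(2) by (simp add: calibrated_def)
  from boltzmann_expectation_sums[OF assms(1) z _ M assms(4)]
    boltzmann_expectation_sums[OF assms(1) z _ N assms(3)]
  show "(\<lambda>j. part_wt q z1 z2 j / (1 + part_wt q z1 z2 j)) sums M"
    "(\<lambda>j. real (Suc j ^ q) * (part_wt q z1 z2 j / (1 + part_wt q z1 z2 j))) sums N" by simp_all
qed

section \<open>Riemann sums and the gamma distribution\<close>

text \<open>An incomplete gamma integral after the substitution \<open>u = t ^ q\<close>, in the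
  variable in which the weights form Riemann sums.\<close>

definition exp_power_integral :: "nat \<Rightarrow> real \<Rightarrow> real" where
  "exp_power_integral q X = integral {0..X} (\<lambda>t. exp (- (t ^ q)))"

lemma exp_power_integral_diff_bounds:
  assumes "0 \<le> a" "a \<le> b"
  shows "(b - a) * exp (- (b ^ q)) \<le> exp_power_integral q b - exp_power_integral q a"
    and "exp_power_integral q b - exp_power_integral q a \<le> (b - a) * exp (- (a ^ q))"
proof -
  let ?f = "\<lambda>t::real. exp (- (t ^ q))"
  have int: "?f integrable_on {c..d}" for c d
    by (intro integrable_continuous_real continuous_intros)
  have eq: "exp_power_integral q b - exp_power_integral q a = integral {a..b} ?f"
    unfolding exp_power_integral_def
    using Henstock_Kurzweil_Integration.integral_combine[of 0 a b ?f] assms int by simp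
  have "integral {a..b} (\<lambda>_. ?f b) \<le> integral {a..b} ?f"
    using assms by (intro integral_le int) (auto intro!: power_mono)
  thus "(b - a) * ?f b \<le> exp_power_integral q b - exp_power_integral q a"
    using assms by (simp add: eq)
  have "integral {a..b} ?f \<le> integral {a..b} (\<lambda>_. ?f a)"
    using assms by (intro integral_le int) (auto intro!: power_mono)
  thus "exp_power_integral q b - exp_power_integral q a \<le> (b - a) * ?f a"
    using assms by (simp add: eq)
qed

text \<open>The integrand decreases on the nonnegative axis, so right-endpoint sums stay below the
  integral and left-endpoint sums above it. The two differ by a telescoping sum of at most
  \<open>d\<close>, uniformly in \<open>n\<close>.\<close>

lemma exp_power_riemann_sum_bounds:
  assumes "0 \<le> d" "q \<ge> 1"
  shows "exp_power_integral q (real n * d) - d \<le> d * (\<Sum>j<n. exp (- ((d * real (Suc j)) ^ q)))"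
    and "d * (\<Sum>j<n. exp (- ((d * real (Suc j)) ^ q))) \<le> exp_power_integral q (real n * d)"
proof -
  let ?f = "\<lambda>j. exp (- ((d * real j) ^ q))"
  \<comment> \<open>The induction needs the exact telescoped error \<open>d * (?f 0 - ?f n)\<close>;
    here \<open>?f 0 = 1\<close> because \<open>q \<ge> 1\<close>.\<close>
  have "exp_power_integral q (real n * d) - d * (1 - ?f n) \<le> d * (\<Sum>j<n. ?f (Suc j))
    \<and> d * (\<Sum>j<n. ?f (Suc j)) \<le> exp_power_integral q (real n * d)"
  proof (induction n)
    case 0
    show ?case using assms by (simp add: exp_power_integral_def)
  next
    case (Suc n)
    have "d * ?f (Suc n) \<le> exp_power_integral q (real (Suc n) * d)
        - exp_power_integral q (real n * d)"
      "exp_power_integral q (real (Suc n) * d) - exp_power_integral q (real n * d) \<le> d * ?f n"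
      using exp_power_integral_diff_bounds[of "real n * d" "real (Suc n) * d" q] assms
      by (simp_all add: algebra_simps)
    thus ?case using Suc by (simp only: sum.lessThan_Suc distrib_left right_diff_distrib) linarith
  qed
  moreover have "0 \<le> d * ?f n" using assms by simp
  ultimately show "exp_power_integral q (real n * d) - d \<le> d * (\<Sum>j<n. ?f (Suc j))"
    "d * (\<Sum>j<n. ?f (Suc j)) \<le> exp_power_integral q (real n * d)"
    by (simp_all only: right_diff_distrib) linarith
qed

text \<open>The second \<open>d\<close> in the error pays for rounding the cutoff \<open>X\<close>
  down to a multiple of \<open>d\<close>, since the integrand is at most 1.\<close>

lemma exp_power_riemann_sum_le:
  assumes "0 < d" "0 \<le> X" "q \<ge> 1"
  defines "n \<equiv> nat \<lfloor>X / d\<rfloor>"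
  shows "exp_power_integral q X - 2 * d \<le> d * (\<Sum>j<n. exp (- ((d * real (Suc j)) ^ q)))"
    and "d * (\<Sum>j<n. exp (- ((d * real (Suc j)) ^ q))) \<le> exp_power_integral q X"
proof -
  have n: "real n \<le> X / d" "X / d \<le> real n + 1"
    using assms(1,2) unfolding n_def by (auto simp: of_nat_nat)
  hence X: "real n * d \<le> X" "X - real n * d \<le> d"
    using assms(1) by (simp_all add: field_simps)
  have "(X - real n * d) * exp (- ((real n * d) ^ q)) \<le> d * 1"
    using X assms(1) by (intro mult_mono) auto
  moreover have "0 \<le> (X - real n * d) * exp (- (X ^ q))" using X by simp
  moreover note exp_power_integral_diff_bounds[OF _ X(1), of q]
  moreover have "0 \<le> real n * d" using assms(1) by simp
  ultimately have "exp_power_integral q X - d \<le> exp_power_integral q (real n * d)"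
    "exp_power_integral q (real n * d) \<le> exp_power_integral q X"
    by fastforce+
  thus "exp_power_integral q X - 2 * d \<le> d * (\<Sum>j<n. exp (- ((d * real (Suc j)) ^ q)))"
    "d * (\<Sum>j<n. exp (- ((d * real (Suc j)) ^ q))) \<le> exp_power_integral q X"
    using exp_power_riemann_sum_bounds[of d q n] assms(1,3) by simp_all
qed

section \<open>Substitution to the gamma distribution function\<close>

lemma powr_inverse_power:
  assumes "q \<ge> 1" "0 \<le> (u::real)"
  shows "(u powr (1 / real q)) ^ q = u"
  using assms by (cases "u = 0") (simp_all add: powr_powr flip: powr_realpow)

lemma gamma_cdf_eq_exp_power_integral:
  assumes "q \<ge> 1" "0 \<le> x"
  shows "gamma_cdf (1 / real q) x
      = real q / Gamma (1 / real q) * exp_power_integral q (x powr (1 / real q))"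
proof -
  let ?g = "\<lambda>u::real. u powr (1 / real q)" and ?f = "\<lambda>t. exp (- (t ^ q))"
  have g0: "?g 0 = 0" by simp
  have pow: "?g u ^ q = u" if "0 \<le> u" for u
    using that assms by (intro powr_inverse_power)
  have "((\<lambda>u. (1 / real q * u powr (1 / real q - 1)) *\<^sub>R ?f (?g u))
      has_integral (integral {?g 0..?g x} ?f)) {0..x}"
  \<comment> \<open>The exceptional set \<open>{0}\<close> is there because
    \<open>u powr (1 / real q)\<close> has no finite derivative at 0 when
    \<open>q > 1\<close>.\<close>
  proof (rule has_integral_substitution_strong[where s = "{0}" and c = 0 and d = "?g x"])
    show "?g ` {0..x} \<subseteq> {0..?g x}" by (auto intro!: powr_mono2)
    show "continuous_on {0..x} ?g" using assms by (intro continuous_on_powr' continuous_intros) auto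
    fix u assume "u \<in> {0..x} - {0}"
    thus "(?g has_field_derivative 1 / real q * u powr (1 / real q - 1)) (at u within {0..x})"
      by (intro has_field_derivative_at_within[OF has_real_derivative_powr]) auto
  qed (use assms in \<open>auto intro!: continuous_intros\<close>)
  hence "((\<lambda>u. real q * ((1 / real q * u powr (1 / real q - 1)) *\<^sub>R ?f (?g u))) has_integral
      real q * exp_power_integral q (?g x)) {0..x}"
    unfolding exp_power_integral_def g0 by (rule has_integral_mult_right)
  hence "((\<lambda>u. u powr (1 / real q - 1) * exp (- u))
      has_integral real q * exp_power_integral q (?g x)) {0..x}"
    by (rule has_integral_eq[rotated]) (use assms pow in auto)
  thus ?thesis by (simp add: gamma_cdf_def integral_unique)
qed

text \<open>Dominated convergence for the truncated Gamma integrals, with the full integrand as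
  majorant.\<close>

lemma gamma_cdf_tendsto_1:
  assumes "0 < \<alpha>" "filterlim X at_top sequentially"
  shows "(\<lambda>n. gamma_cdf \<alpha> (X n)) \<longlonglongrightarrow> 1"
proof -
  let ?g = "\<lambda>u. u powr (\<alpha> - 1) * exp (- u)"
  have g: "(?g has_integral Gamma \<alpha>) {0..}"
    using Gamma_integral_real[OF assms(1)] by (simp add: exp_minus field_simps)
  have restrict: "integral {0..} (\<lambda>u. if u \<in> {..X n} then ?g u else 0) = integral {0..X n} ?g" for n
    by (subst integral_restrict_Int) (simp add: atLeastAtMost_def Int_commute)
  have "(\<lambda>n. integral {0..} (\<lambda>u. if u \<in> {..X n} then ?g u else 0)) \<longlonglongrightarrow> integral {0..} ?g"
  proof (rule dominated_convergence(2)[where h = ?g])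
    fix n
    have "?g integrable_on {0..X n}"
      by (rule integrable_on_subinterval[OF has_integral_integrable[OF g]]) auto
    thus "(\<lambda>u. if u \<in> {..X n} then ?g u else 0) integrable_on {0..}"
      by (subst integrable_restrict_Int) (simp add: atLeastAtMost_def Int_commute)
  next
    fix u :: real
    have "\<forall>\<^sub>F n in sequentially. u \<le> X n" using assms(2) by (simp add: filterlim_at_top)
    hence "\<forall>\<^sub>F n in sequentially. (if u \<in> {..X n} then ?g u else 0) = ?g u"
      by (rule eventually_mono) simp
    thus "(\<lambda>n. if u \<in> {..X n} then ?g u else 0) \<longlonglongrightarrow> ?g u"
      by (rule tendsto_eventually)
  qed (use g in auto)
  hence "(\<lambda>n. integral {0..X n} ?g) \<longlonglongrightarrow> Gamma \<alpha>"
    using g by (simp only: restrict integral_unique)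
  moreover have "Gamma \<alpha> > 0" using assms by (rule_tac Gamma_real_pos)
  ultimately show ?thesis unfolding gamma_cdf_def
    using tendsto_divide[OF _ tendsto_const, of "\<lambda>n. integral {0..X n} ?g" "Gamma \<alpha>" sequentially
        "Gamma \<alpha>"] by simp
qed

lemma exp_power_integral_tendsto:
  assumes "q \<ge> 1" "0 < d"
  shows "(\<lambda>n. exp_power_integral q (real n * d)) \<longlonglongrightarrow> Gamma (1 / real q) / real q"
proof -
  have Gam: "Gamma (1 / real q) > 0" using assms by (intro Gamma_real_pos) simp
  have lim: "filterlim (\<lambda>n. (real n * d) ^ q) at_top sequentially"
    using assms by (intro filterlim_pow_at_top filterlim_at_top_mult_tendsto_pos
      [OF tendsto_const _ filterlim_real_sequentially]) auto
  have root: "((real n * d) ^ q) powr (1 / real q) = real n * d" for n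
    using assms powr_inverse_power[of q "real n * d"]
    by (cases "n = 0") (simp_all add: powr_powr flip: powr_realpow)
  have "gamma_cdf (1 / real q) ((real n * d) ^ q) * (Gamma (1 / real q) / real q)
      = exp_power_integral q (real n * d)" for n
    using gamma_cdf_eq_exp_power_integral[OF assms(1), of "(real n * d) ^ q"] assms
    by (simp add: root Gam[THEN less_imp_neq, symmetric])
  moreover have "(\<lambda>n. gamma_cdf (1 / real q) ((real n * d) ^ q) * (Gamma (1 / real q) / real q))
      \<longlonglongrightarrow> 1 * (Gamma (1 / real q) / real q)"
    using assms lim by (intro tendsto_mult tendsto_const gamma_cdf_tendsto_1) auto
  ultimately show ?thesis by simp
qed

text \<open>The error in the finite Riemann sums does not depend on \<open>n\<close>, so both bounds
  survive the limit.\<close>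

lemma exp_power_riemann_suminf_bounds:
  assumes "q \<ge> 1" "0 < d"
  shows "Gamma (1 / real q) / real q - d \<le> d * (\<Sum>j. exp (- ((d * real (Suc j)) ^ q)))"
    and "d * (\<Sum>j. exp (- ((d * real (Suc j)) ^ q))) \<le> Gamma (1 / real q) / real q"
proof -
  \<comment> \<open>Summability is inherited from the weights with parameters
    \<open>exp (- (d ^ q))\<close> and 1.\<close>
  have "part_wt q (exp (- (d ^ q))) 1 = (\<lambda>j. exp (- ((d * real (Suc j)) ^ q)))"
    by (auto simp: fun_eq_iff part_wt_def power_mult_distrib mult.commute[of "d ^ q"]
        simp flip: exp_of_nat_mult of_nat_Suc)
  hence "summable (\<lambda>j. exp (- ((d * real (Suc j)) ^ q)))"
    using summable_part_wt[of q "exp (- (d ^ q))" 1] assms by simp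
  hence lim: "(\<lambda>n. d * (\<Sum>j<n. exp (- ((d * real (Suc j)) ^ q))))
      \<longlonglongrightarrow> d * (\<Sum>j. exp (- ((d * real (Suc j)) ^ q)))"
    by (intro tendsto_mult tendsto_const summable_LIMSEQ)
  note I = exp_power_integral_tendsto[OF assms]
  show "Gamma (1 / real q) / real q - d \<le> d * (\<Sum>j. exp (- ((d * real (Suc j)) ^ q)))"
    using assms exp_power_riemann_sum_bounds(1)[of d q]
    by (intro LIMSEQ_le[OF tendsto_diff[OF I tendsto_const] lim]) auto
  show "d * (\<Sum>j. exp (- ((d * real (Suc j)) ^ q))) \<le> Gamma (1 / real q) / real q"
    using assms exp_power_riemann_sum_bounds(2)[of d q]
    by (intro LIMSEQ_le[OF lim I]) auto
qed

section \<open>Calibration\<close>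

lemma log_partition_sum_eq_suminf:
  "log_partition_sum q z1 z2 UNIV = (\<Sum>j. ln (1 + part_wt q z1 z2 j))"
  by (simp add: log_partition_sum_def)

lemma log_partition_sum_lessThan:
  "log_partition_sum q z1 z2 {..<n} = (\<Sum>j<n. ln (1 + part_wt q z1 z2 j))"
  unfolding log_partition_sum_def
  by (subst suminf_finite[of "{..<n}"]) (auto simp: indicator_def)

lemma part_wt_eq_exp:
  assumes "q \<ge> 1" "0 < z1" "z1 < 1"
  shows "part_wt q z1 z2 j = z2 * exp (- (((- ln z1) powr (1 / real q) * real (Suc j)) ^ q))"
proof -
  have "((- ln z1) powr (1 / real q) * real (Suc j)) ^ q = real (Suc j ^ q) * - ln z1"
    using assms by (simp only: power_mult_distrib powr_inverse_power of_nat_power)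
      (simp add: mult.commute powr_inverse_power)
  moreover have "z1 ^ (Suc j ^ q) = exp (real (Suc j ^ q) * ln z1)"
    using assms by (simp only: exp_of_nat_mult exp_ln)
  ultimately show ?thesis by (simp add: part_wt_def)
qed

lemma scaled_part_le_iff:
  assumes "q \<ge> 1" "0 < g" "0 \<le> x"
  shows "{j. g * real (Suc j ^ q) \<le> x} = {..<nat \<lfloor>x powr (1 / real q) / g powr (1 / real q)\<rfloor>}"
proof -
  let ?d = "g powr (1 / real q)" and ?X = "x powr (1 / real q)"
  have "g * real (Suc j ^ q) \<le> x \<longleftrightarrow> j < nat \<lfloor>?X / ?d\<rfloor>" for j
  proof -
    have "g * real (Suc j ^ q) = (?d * real (Suc j)) ^ q"
      using assms by (simp only: power_mult_distrib powr_inverse_power less_imp_le of_nat_power)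
    moreover have "x = ?X ^ q" using assms by (simp add: powr_inverse_power)
    ultimately have "g * real (Suc j ^ q) \<le> x \<longleftrightarrow> (?d * real (Suc j)) ^ q \<le> ?X ^ q" by simp
    also have "\<dots> \<longleftrightarrow> ?d * real (Suc j) \<le> ?X"
      using assms by (intro power_mono_iff) auto
    also have "\<dots> \<longleftrightarrow> real (Suc j) \<le> ?X / ?d" using assms by (simp add: field_simps)
    also have "\<dots> \<longleftrightarrow> int (Suc j) \<le> \<lfloor>?X / ?d\<rfloor>" by (simp only: le_floor_iff of_int_of_nat_eq)
    \<comment> \<open>The shift of the index makes the floor itself the number of admissible
      \<open>j\<close>; all values below it occur.\<close>
    also have "\<dots> \<longleftrightarrow> j < nat \<lfloor>?X / ?d\<rfloor>" by linarith
    finally show ?thesis .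
  qed
  thus ?thesis by auto
qed

text \<open>A subseries, along distinct exponents, of the differentiated geometric series.\<close>

lemma summable_scaled_geometric:
  assumes "q \<ge> 1" "0 < r" "r < 1"
  shows "summable (\<lambda>j. real (Suc j ^ q) * r ^ (Suc j ^ q))"
proof -
  have "summable (\<lambda>n. real (Suc n) * r ^ n)"
    using geometric_deriv_sums[of r] assms by (auto simp: sums_iff)
  hence "summable (\<lambda>n. real n * r ^ n)"
    by (rule summable_comparison_test'[where N = 0])
       (use assms in \<open>auto intro!: mult_right_mono\<close>)
  from summable_reindex[OF this inj_power_Suc[OF assms(1)]] show ?thesis
    using assms by (simp add: o_def)
qed

text \<open>
  Since \<open>M\<close> is fixed and the occupation probabilities decrease, the weight \<open>w J\<close>
  of some fixed index \<open>J\<close> is at most \<open>1\<close>; beyond \<open>J\<close> the weights decay geometrically with ratio \<open>z1\<close>.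
\<close>

lemma calibrated_weight_bounded:
  assumes "q \<ge> 1" "0 < M" "0 < c"
  obtains C where "\<And>z1 z2 N. calibrated q z1 z2 N M \<Longrightarrow> 0 < N \<Longrightarrow> c \<le> - ln z1 \<Longrightarrow> N \<le> C"
proof -
  \<comment> \<open>Chosen so that \<open>2 * M \<le> real (Suc J)\<close>: the first
    \<open>Suc J\<close> probabilities are each at least \<open>?p J\<close> and sum to at most
    \<open>M\<close>, whence \<open>?p J \<le> 1 / 2\<close> and
    \<open>?w J \<le> 1\<close>.\<close>
  define J where "J = nat \<lceil>2 * M\<rceil>"
  let ?a = "\<lambda>j. real (Suc j ^ q)"
  define r where "r = exp (- c)"
  have r: "0 < r" "r < 1" using assms by (simp_all add: r_def)
  \<comment> \<open>This majorant depends on \<open>q\<close>, \<open>M\<close> and \<open>c\<close>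
    only, which makes the bound on \<open>N\<close> uniform in \<open>z1\<close> and
    \<open>z2\<close>.\<close>
  let ?b = "\<lambda>j. ?a j * (r ^ (Suc j ^ q) / r ^ (Suc J ^ q))"
  have sb: "summable ?b"
    using summable_divide[OF summable_scaled_geometric[OF assms(1) r], of "r ^ (Suc J ^ q)"] by simp
  have "N \<le> suminf ?b" if cal: "calibrated q z1 z2 N M" and "0 < N" "c \<le> - ln z1" for z1 z2 N
  proof -
    let ?w = "part_wt q z1 z2"
    let ?p = "\<lambda>j. ?w j / (1 + ?w j)"
    have z: "0 < z1" "z1 < 1" "0 < z2" using cal by (auto simp: calibrated_def)
    have "z1 \<le> r" using that(3) z unfolding r_def
        by (simp add: ln_ge_iff[symmetric] flip: ln_le_cancel_iff)
    have w: "0 < ?w j" for j using part_wt_pos z by blast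
    have p: "0 \<le> ?p j" "?p j \<le> 1" "?p j \<le> ?w j" for j
      using w[of j] by (simp_all add: field_simps)
    note sums = calibrated_sums[OF assms(1) cal \<open>0 < N\<close> \<open>0 < M\<close>]
    have w_mono: "?w j \<le> ?w i" if "i \<le> j" for i j
      using z that unfolding part_wt_def by (intro mult_left_mono power_decreasing power_mono) auto
    have p_mono: "?p J \<le> ?p j" if "j \<le> J" for j
      using w[of j] w[of J] w_mono[OF that] by (simp add: field_simps)
    have "real (Suc J) * ?p J = (\<Sum>j<Suc J. ?p J)" by simp
    also have "\<dots> \<le> (\<Sum>j<Suc J. ?p j)" using p_mono by (intro sum_mono) simp
    also have "\<dots> \<le> M"
      using sum_le_suminf[OF sums_summable[OF sums(1)], of "{..<Suc J}"] p sums_unique[OF sums(1)]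
          by simp
    finally have "real (Suc J) * ?p J \<le> M" .
    moreover have "2 * M \<le> real (Suc J)" unfolding J_def by linarith
    hence "2 * M * ?p J \<le> real (Suc J) * ?p J" using p by (intro mult_right_mono) auto
    ultimately have "2 * M * ?p J \<le> M" by linarith
    hence "M * (2 * ?p J) \<le> M * 1" by (simp only: mult.left_commute mult.assoc mult_1_right)
    hence "2 * ?p J \<le> 1" using \<open>0 < M\<close> mult_le_cancel_left_pos by blast
    hence wJ: "?w J \<le> 1" using w[of J] by (simp add: field_simps)
    \<comment> \<open>Up to \<open>J\<close> the bound is at least 1 and any probability obeys it.
      Beyond \<open>J\<close> the decay relative to \<open>?w J\<close> is used.\<close>
    have "?p j \<le> r ^ (Suc j ^ q) / r ^ (Suc J ^ q)" for j
    proof (cases "j \<le> J")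
      case True
      hence "r ^ (Suc J ^ q) \<le> r ^ (Suc j ^ q)"
        using r by (intro power_decreasing power_mono) auto
      hence "1 \<le> r ^ (Suc j ^ q) / r ^ (Suc J ^ q)" using r by simp
      thus ?thesis using p(2)[of j] by linarith
    next
      case False
      hence le: "Suc J ^ q \<le> Suc j ^ q" by (intro power_mono) auto
      have "?w j = ?w J * z1 ^ (Suc j ^ q - Suc J ^ q)"
        using le by (simp add: part_wt_def flip: power_add)
      also have "\<dots> \<le> 1 * r ^ (Suc j ^ q - Suc J ^ q)"
        using wJ \<open>z1 \<le> r\<close> z by (intro mult_mono power_mono) auto
      also have "\<dots> = r ^ (Suc j ^ q) / r ^ (Suc J ^ q)"
        using r le by (simp add: power_diff)
      finally show ?thesis using p(3)[of j] by linarith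
    qed
    hence "?a j * ?p j \<le> ?b j" for j by (intro mult_left_mono) auto
    hence "(\<Sum>j. ?a j * ?p j) \<le> suminf ?b"
      by (intro suminf_le sums_summable[OF sums(2)] sb)
    thus ?thesis using sums_unique[OF sums(2)] by simp
  qed
  thus thesis by (rule that)
qed

text \<open>As long as \<open>- ln (z1 N)\<close> is at least \<open>c\<close>, the mean weight
  \<open>N\<close> stays below a constant, which is impossible for large \<open>N\<close>.\<close>

lemma calibrated_gamma_tendsto_0:
  assumes "q \<ge> 1" "0 < M" "\<forall>\<^sub>F N in at_top. calibrated q (z1 N) (z2 N) N M"
  shows "((\<lambda>N. - ln (z1 N)) \<longlongrightarrow> 0) at_top"
proof (rule tendstoI)
  fix c :: real assume "0 < c"
  from calibrated_weight_bounded[OF assms(1,2) this] obtain C where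
    C: "\<And>z1 z2 N. calibrated q z1 z2 N M \<Longrightarrow> 0 < N \<Longrightarrow> c \<le> - ln z1 \<Longrightarrow> N \<le> C" by metis
  show "\<forall>\<^sub>F N in at_top. dist (- ln (z1 N)) 0 < c"
    using assms(3) eventually_gt_at_top[of 0] eventually_gt_at_top[of C]
  proof eventually_elim
    case (elim N)
    hence "\<not> c \<le> - ln (z1 N)" using C[of "z1 N" "z2 N" N] by auto
    moreover have "ln (z1 N) < 0" using elim by (simp add: calibrated_def)
    ultimately show ?case by (simp add: dist_real_def)
  qed
qed

section \<open>Comparison of logarithms with weights\<close>

lemma ln_one_plus_ge:
  fixes x :: real
  assumes "0 < x"
  shows "x / (1 + x) \<le> ln (1 + x)"
  using ln_le_minus_one[of "1 / (1 + x)"] assms by (simp add: ln_div field_simps)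

text \<open>Termwise \<open>w / (1 + w) \<le> ln (1 + w) \<le> w \<le> (1 + z2) * (w / (1 +
  w))\<close>, as no weight exceeds \<open>z2\<close>, and the outer series is known from
  calibration. The chain closes up once \<open>z2\<close> tends to 0.\<close>

lemma calibrated_suminf_bounds:
  assumes "q \<ge> 1" "calibrated q z1 z2 N M" "0 < N" "0 < M"
  shows "M \<le> log_partition_sum q z1 z2 UNIV"
    and "log_partition_sum q z1 z2 UNIV \<le> (\<Sum>j. part_wt q z1 z2 j)"
    and "(\<Sum>j. part_wt q z1 z2 j) \<le> (1 + z2) * M"
proof -
  let ?w = "part_wt q z1 z2"
  have z: "0 < z1" "z1 < 1" "0 < z2" using assms(2) by (auto simp: calibrated_def)
  have w: "0 < ?w j" for j using part_wt_pos z by blast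
  have w_le: "?w j \<le> z2" for j using z by (simp add: part_wt_def power_le_one mult_left_le)
  note p = calibrated_sums(1)[OF assms]
  note sw = summable_part_wt[OF assms(1) z] and sl = summable_ln_part_wt[OF assms(1) z]
  show "M \<le> log_partition_sum q z1 z2 UNIV"
    unfolding log_partition_sum_eq_suminf sums_unique[OF p]
    by (intro suminf_le sums_summable[OF p] sl ln_one_plus_ge w)
  show "log_partition_sum q z1 z2 UNIV \<le> (\<Sum>j. ?w j)"
    unfolding log_partition_sum_eq_suminf
    by (intro suminf_le sl sw ln_part_wt_le z)
  have "?w j \<le> (1 + z2) * (?w j / (1 + ?w j))" for j
    using w[of j] w_le[of j] z by (simp add: field_simps)
  hence "(\<Sum>j. ?w j) \<le> (\<Sum>j. (1 + z2) * (?w j / (1 + ?w j)))"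
    by (intro suminf_le sw summable_mult sums_summable[OF p])
  also have "\<dots> = (1 + z2) * M" using sums_unique[OF sums_mult[OF p]] by simp
  finally show "(\<Sum>j. ?w j) \<le> (1 + z2) * M" .
qed

lemma log_partition_sum_lessThan_bounds:
  assumes "0 < z1" "z1 < 1" "0 < z2"
  shows "(\<Sum>j<n. part_wt q z1 z2 j) / (1 + z2) \<le> log_partition_sum q z1 z2 {..<n}"
    and "log_partition_sum q z1 z2 {..<n} \<le> (\<Sum>j<n. part_wt q z1 z2 j)"
proof -
  let ?w = "part_wt q z1 z2"
  have w: "0 < ?w j" for j using part_wt_pos assms by blast
  have w_le: "?w j \<le> z2" for j using assms by (simp add: part_wt_def power_le_one mult_left_le)
  have "?w j / (1 + z2) \<le> ?w j / (1 + ?w j)" for j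
    using w[of j] w_le[of j] assms by (intro divide_left_mono) auto
  hence "?w j / (1 + z2) \<le> ln (1 + ?w j)" for j
    using ln_one_plus_ge[OF w, of j] by (meson order.trans)
  thus "(\<Sum>j<n. ?w j) / (1 + z2) \<le> log_partition_sum q z1 z2 {..<n}"
    unfolding log_partition_sum_lessThan sum_divide_distrib by (intro sum_mono)
  show "log_partition_sum q z1 z2 {..<n} \<le> (\<Sum>j<n. ?w j)"
    unfolding log_partition_sum_lessThan by (intro sum_mono ln_part_wt_le assms)
qed

text \<open>The total weight is \<open>z2 / d\<close> times a Riemann sum tending to
  \<open>L\<close>. Calibration pins the total to \<open>M\<close>, which yields first that
  \<open>z2\<close> vanishes and then that \<open>z2 / d\<close> tends to \<open>M / L\<close>; the
  partial sums follow by the same scaling.\<close>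

lemma log_partition_sum_limits:
  assumes "q \<ge> 1" "0 < M" "\<forall>\<^sub>F N in at_top. calibrated q (z1 N) (z2 N) N M"
  shows "((\<lambda>N. log_partition_sum q (z1 N) (z2 N) UNIV) \<longlongrightarrow> M) at_top"
    and "0 \<le> x \<Longrightarrow> ((\<lambda>N. log_partition_sum q (z1 N) (z2 N) {j. - ln (z1 N) * real (Suc j ^ q) \<le> x})
          \<longlongrightarrow> M * gamma_cdf (1 / real q) x) at_top"
proof -
  define d where "d N = (- ln (z1 N)) powr (1 / real q)" for N
  define S where "S N = d N * (\<Sum>j. exp (- ((d N * real (Suc j)) ^ q)))" for N
  define W where "W N = (\<Sum>j. part_wt q (z1 N) (z2 N) j)" for N
  \<comment> \<open>The integral of \<open>exp (- (t ^ q))\<close> over the half-line, also equal to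
    \<open>Gamma (1 + 1 / real q)\<close>.\<close>
  define L where "L = Gamma (1 / real q) / real q"
  have L: "0 < L" using assms(1) unfolding L_def by (intro divide_pos_pos Gamma_real_pos) auto
  have ev: "\<forall>\<^sub>F N in at_top. calibrated q (z1 N) (z2 N) N M \<and> 0 < N \<and> 0 < z1 N \<and> z1 N < 1
      \<and> 0 < z2 N \<and> 0 < - ln (z1 N) \<and> 0 < d N"
    using assms(3) eventually_gt_at_top[of 0]
    by eventually_elim (auto simp: calibrated_def d_def)
  have d0: "(d \<longlongrightarrow> 0) at_top"
  proof -
    \<comment> \<open>At base 0 the continuity of \<open>powr\<close> requires a positive exponent
      and eventually nonnegative bases.\<close>
    have "(d \<longlongrightarrow> 0 powr (1 / real q)) at_top"
      unfolding d_def
      by (intro tendsto_powr' calibrated_gamma_tendsto_0[OF assms] tendsto_const disjI2 conjI)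
         (use assms(1) ev in \<open>auto elim!: eventually_mono\<close>)
    thus ?thesis by simp
  qed
  have S_bounds: "\<forall>\<^sub>F N in at_top. L - d N \<le> S N \<and> S N \<le> L"
    using ev by eventually_elim (auto simp: S_def L_def exp_power_riemann_suminf_bounds
        [OF assms(1)] simp del: of_nat_Suc)
  have S_lim: "(S \<longlongrightarrow> L) at_top"
    by (rule tendsto_sandwich[of "\<lambda>N. L - d N" _ _ "\<lambda>_. L"])
       (use S_bounds tendsto_diff[OF tendsto_const d0, of L] in \<open>auto elim: eventually_mono\<close>)
  have W_eq: "\<forall>\<^sub>F N in at_top. W N = z2 N / d N * S N"
    using ev
  proof eventually_elim
    case (elim N)
    have "part_wt q (z1 N) (z2 N) = (\<lambda>j. z2 N * exp (- ((d N * real (Suc j)) ^ q)))"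
      using elim part_wt_eq_exp[OF assms(1), of "z1 N" "z2 N"] by (auto simp only: d_def fun_eq_iff)
    moreover from this have "summable (\<lambda>j. z2 N * exp (- ((d N * real (Suc j)) ^ q)))"
      using summable_part_wt[OF assms(1), of "z1 N" "z2 N"] elim by (simp only:)
    hence "summable (\<lambda>j. exp (- ((d N * real (Suc j)) ^ q)))"
      using elim by (auto simp: summable_cmult_iff)
    ultimately show ?case using elim by (simp add: W_def S_def suminf_mult)
  qed
  have W_bounds: "\<forall>\<^sub>F N in at_top. M \<le> log_partition_sum q (z1 N) (z2 N) UNIV
      \<and> log_partition_sum q (z1 N) (z2 N) UNIV \<le> W N \<and> W N \<le> (1 + z2 N) * M"
    using ev by eventually_elim (auto simp only: W_def intro!: calibrated_suminf_bounds assms(1,2))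
  have z2_lim: "(z2 \<longlongrightarrow> 0) at_top"
  proof -
    \<comment> \<open>The calibration bound has \<open>z2\<close> on both sides. Passing to
      \<open>z2 / (1 + z2)\<close> isolates it under a bound of order \<open>d\<close>, and
      \<open>u / (1 - u)\<close> recovers \<open>z2\<close>.\<close>
    define u where "u N = z2 N / (1 + z2 N)" for N
    have "\<forall>\<^sub>F N in at_top. 0 < S N" using order_tendstoD(1)[OF S_lim L] .
    hence "\<forall>\<^sub>F N in at_top. 0 \<le> u N \<and> u N \<le> M * d N / S N"
      using ev W_eq W_bounds
    proof eventually_elim
      case (elim N)
      have "z2 N / d N * S N \<le> (1 + z2 N) * M" using elim by simp
      hence "z2 N / (1 + z2 N) \<le> M * d N / S N"
        using elim by (simp add: field_simps)
      thus ?case using elim by (simp add: u_def)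
    qed
    moreover have "((\<lambda>N. M * d N / S N) \<longlongrightarrow> M * 0 / L) at_top"
      using L by (intro tendsto_intros d0 S_lim) auto
    ultimately have u: "(u \<longlongrightarrow> 0) at_top"
      by (intro tendsto_sandwich[of "\<lambda>_. 0" u _ "\<lambda>N. M * d N / S N"]) (auto elim: eventually_mono)
    have "((\<lambda>N. u N / (1 - u N)) \<longlongrightarrow> 0 / (1 - 0)) at_top"
      by (intro tendsto_intros u) auto
    moreover have "\<forall>\<^sub>F N in at_top. u N / (1 - u N) = z2 N"
      using ev by eventually_elim (simp add: u_def field_simps)
    ultimately show ?thesis by (simp add: tendsto_cong)
  qed
  have upper: "((\<lambda>N. (1 + z2 N) * M) \<longlongrightarrow> M) at_top"
    using tendsto_mult[OF tendsto_add[OF tendsto_const[of 1] z2_lim] tendsto_const[of M]] by simp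
  show "((\<lambda>N. log_partition_sum q (z1 N) (z2 N) UNIV) \<longlongrightarrow> M) at_top"
    by (rule tendsto_sandwich[OF _ _ tendsto_const upper])
       (use W_bounds in \<open>auto elim!: eventually_mono\<close>)
  have W_lim: "(W \<longlongrightarrow> M) at_top"
    by (rule tendsto_sandwich[OF _ _ tendsto_const upper])
       (use W_bounds in \<open>auto elim!: eventually_mono\<close>)
  have "((\<lambda>N. W N / S N) \<longlongrightarrow> M / L) at_top"
    using L by (intro tendsto_intros W_lim S_lim) auto
  moreover have "\<forall>\<^sub>F N in at_top. W N / S N = z2 N / d N"
    using W_eq order_tendstoD(1)[OF S_lim L] by eventually_elim simp
  ultimately have ratio: "((\<lambda>N. z2 N / d N) \<longlongrightarrow> M / L) at_top"
    by (simp add: tendsto_cong)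
  assume x: "0 \<le> x"
  define X where "X = x powr (1 / real q)"
  define n where "n N = nat \<lfloor>X / d N\<rfloor>" for N
  define R where "R N = d N * (\<Sum>j<n N. exp (- ((d N * real (Suc j)) ^ q)))" for N
  have X: "0 \<le> X" by (simp add: X_def)
  have R_bounds: "\<forall>\<^sub>F N in at_top. exp_power_integral q X - 2 * d N \<le> R N
      \<and> R N \<le> exp_power_integral q X"
    using ev by eventually_elim (auto simp: R_def n_def exp_power_riemann_sum_le[OF _ X assms(1)]
        simp del: of_nat_Suc)
  have "((\<lambda>N. exp_power_integral q X - 2 * d N) \<longlongrightarrow> exp_power_integral q X - 2 * 0) at_top"
    by (intro tendsto_intros d0)
  hence R_lim: "(R \<longlongrightarrow> exp_power_integral q X) at_top"
    by (intro tendsto_sandwich[of "\<lambda>N. exp_power_integral q X - 2 * d N" R _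
        "\<lambda>_. exp_power_integral q X"])
       (use R_bounds in \<open>auto elim: eventually_mono\<close>)
  \<comment> \<open>\<open>M / L\<close> times the incomplete integral is \<open>M\<close> times the
    distribution function, because \<open>1 / L\<close> is exactly its normalising factor.\<close>
  have P_lim: "((\<lambda>N. z2 N / d N * R N) \<longlongrightarrow> M * gamma_cdf (1 / real q) x) at_top"
    using tendsto_mult[OF ratio R_lim] gamma_cdf_eq_exp_power_integral[OF assms(1) x]
    by (simp add: L_def X_def mult.assoc)
  have P_lim': "((\<lambda>N. z2 N / d N * R N / (1 + z2 N)) \<longlongrightarrow> M * gamma_cdf (1 / real q) x) at_top"
    using tendsto_divide[OF P_lim tendsto_add[OF tendsto_const[of 1] z2_lim]] by simp
  have "\<forall>\<^sub>F N in at_top. z2 N / d N * R N / (1 + z2 N)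
        \<le> log_partition_sum q (z1 N) (z2 N) {j. - ln (z1 N) * real (Suc j ^ q) \<le> x}
      \<and> log_partition_sum q (z1 N) (z2 N) {j. - ln (z1 N) * real (Suc j ^ q) \<le> x}
          \<le> z2 N / d N * R N"
    using ev
  proof eventually_elim
    case (elim N)
    have "{j. - ln (z1 N) * real (Suc j ^ q) \<le> x} = {..<n N}"
      unfolding n_def X_def d_def by (rule scaled_part_le_iff) (use elim assms(1) x in auto)
    moreover have "(\<Sum>j<n N. part_wt q (z1 N) (z2 N) j) = z2 N / d N * R N"
      using elim part_wt_eq_exp[OF assms(1), of "z1 N" "z2 N"]
      by (simp add: R_def sum_distrib_left d_def[symmetric] del: of_nat_Suc)
    ultimately show ?case
      using log_partition_sum_lessThan_bounds[of "z1 N" "z2 N" q "n N"] elim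
          by (simp only: simp_thms)
  qed
  thus "((\<lambda>N. log_partition_sum q (z1 N) (z2 N) {j. - ln (z1 N) * real (Suc j ^ q) \<le> x})
          \<longlongrightarrow> M * gamma_cdf (1 / real q) x) at_top"
    by (intro tendsto_sandwich[OF _ _ P_lim' P_lim]) (auto elim: eventually_mono)
qed

section \<open>Limit laws\<close>

lemma part_max_pos_iff:
  assumes "l \<in> strict_power_partitions q"
  shows "0 < part_max l \<longleftrightarrow> l \<notin> parts_in q {}"
proof (cases "l = []")
  case False
  hence "Max (set l) \<in> set l" by simp
  hence "0 < Max (set l)" using assms by (auto simp: strict_power_partitions_def)
  thus ?thesis using False by (simp add: part_max_def parts_in_empty)
qed (simp add: part_max_def parts_in_empty)

lemma part_min_finite_iff: "part_min l < \<infinity> \<longleftrightarrow> l \<notin> parts_in q {}"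
  by (simp add: part_min_def parts_in_empty)

text \<open>The removed event consists of the empty partition alone, whose probability is the
  reciprocal of the partition function.\<close>

lemma measure_boltzmann_nonempty:
  assumes "q \<ge> 1" "0 < z1" "z1 < 1" "0 < z2"
  shows "measure (boltzmann q z1 z2) (parts_in q A - parts_in q {})
    = exp (- log_partition_sum q z1 z2 (- A)) - exp (- log_partition_sum q z1 z2 UNIV)"
proof -
  interpret prob_space "boltzmann q z1 z2" by (rule prob_space_boltzmann[OF assms])
  have "parts_in q {} \<subseteq> parts_in q A" by (auto simp: parts_in_def)
  thus ?thesis
    using measure_boltzmann_parts_in[OF assms, of A] measure_boltzmann_parts_in[OF assms, of "{}"]
    by (subst finite_measure_Diff) (auto simp: sets_boltzmann parts_in_subset)
qed

text \<open>These identities are exact, before any limit. Bounding the maximum forbids the indices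
  above a cutoff, at cost \<open>T - S x\<close> in the exponent; bounding the minimum forbids those
  up to it, at cost \<open>S x\<close>.\<close>

lemma boltzmann_extreme_part_probs:
  assumes "q \<ge> 1" "0 < z1" "z1 < 1" "0 < z2"
  defines "g \<equiv> - ln z1" and "B \<equiv> boltzmann q z1 z2"
    and "T \<equiv> log_partition_sum q z1 z2 UNIV"
    and "S \<equiv> \<lambda>x. log_partition_sum q z1 z2 {j. - ln z1 * real (Suc j ^ q) \<le> x}"
  shows "0 \<le> x \<Longrightarrow> \<P>(l in B. g * real (part_max l) \<le> x) = exp (- (T - S x))"
    and "\<P>(l in B. ereal x < ereal g * part_min l) = exp (- S x)"
    and "0 \<le> y \<Longrightarrow> y \<le> x \<Longrightarrow>
      \<P>(l in B. g * real (part_max l) \<le> x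
          \<and> ereal y < ereal g * part_min l) = exp (- (T - S x)) * exp (- S y)"
    and "0 \<le> x \<Longrightarrow>
        \<P>(l in B. g * real (part_max l) \<le> x \<bar> 0 < part_max l)
            = (exp (- (T - S x)) - exp (- T)) / (1 - exp (- T))"
    and "\<P>(l in B. ereal x < ereal g * part_min l \<bar> part_min l < \<infinity>)
        = (exp (- S x) - exp (- T)) / (1 - exp (- T))"
proof -
  let ?a = "\<lambda>x. {j. g * real (Suc j ^ q) \<le> x}" and ?b = "\<lambda>x. {j. x < g * real (Suc j ^ q)}"
  let ?\<Lambda> = "strict_power_partitions q"
  have g: "0 < g" using assms(2,3) by (simp add: g_def)
  have S: "S x = log_partition_sum q z1 z2 (?a x)" for x by (simp only: S_def g_def)
  have compl_b: "- ?b x = ?a x" for x by auto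
  have "T = S x + log_partition_sum q z1 z2 (- ?a x)" for x
    using log_partition_sum_Un[OF assms(1-4), of "?a x" "- ?a x"] by (simp add: T_def S)
  hence compl_a: "log_partition_sum q z1 z2 (- ?a x) = T - S x" for x by (simp add: algebra_simps)
  note space = space_boltzmann[of q z1 z2, folded B_def]
  note P = measure_boltzmann_parts_in[OF assms(1-4), folded B_def]
  note P' = measure_boltzmann_nonempty[OF assms(1-4), folded B_def]
  show "\<P>(l in B. g * real (part_max l) \<le> x) = exp (- (T - S x))" if "0 \<le> x" for x
    by (simp only: space part_max_event[OF g that] P compl_a)
  show "\<P>(l in B. ereal x < ereal g * part_min l) = exp (- S x)" for x
    by (simp only: space part_min_event[OF g] P compl_b S)
  show "\<P>(l in B. g * real (part_max l) \<le> x
      \<and> ereal y < ereal g * part_min l) = exp (- (T - S x)) * exp (- S y)"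
    if "0 \<le> y" "y \<le> x" for x y
  proof -
    have "0 \<le> x" using that by simp
    have "{l \<in> ?\<Lambda>. g * real (part_max l) \<le> x
        \<and> ereal y < ereal g * part_min l} = parts_in q (?a x \<inter> ?b y)"
      unfolding parts_in_Int[OF assms(1)] part_max_event[OF g \<open>0 \<le> x\<close>, symmetric]
        part_min_event[OF g, symmetric] by blast
    moreover have "- (?a x \<inter> ?b y) = - ?a x \<union> ?a y" by auto
    moreover have "log_partition_sum q z1 z2 (- ?a x \<union> ?a y) = (T - S x) + S y"
    proof -
      \<comment> \<open>The only use of \<open>y \<le> x\<close>: the two forbidden index sets are
        disjoint, so their exponents add and the joint law factorises.\<close>
      have "- ?a x \<inter> ?a y = {}" using that by force
      from log_partition_sum_Un[OF assms(1-4) this] show ?thesis by (simp only: compl_a S)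
    qed
    ultimately show ?thesis by (simp only: space P minus_add_distrib exp_add)
  qed
  have UN: "measure B (?\<Lambda> - parts_in q {}) = 1 - exp (- T)"
    using P'[of UNIV] by (simp add: T_def strict_power_partitions_eq log_partition_sum_def)
  show "\<P>(l in B. g * real (part_max l) \<le> x \<bar> 0 < part_max l)
      = (exp (- (T - S x)) - exp (- T)) / (1 - exp (- T))"
    if "0 \<le> x" for x
  proof -
    have "{l \<in> ?\<Lambda>. g * real (part_max l) \<le> x \<and> 0 < part_max l} = parts_in q (?a x) - parts_in q {}"
      unfolding part_max_event[OF g that, symmetric] using part_max_pos_iff by blast
    moreover have "{l \<in> ?\<Lambda>. 0 < part_max l} = ?\<Lambda> - parts_in q {}"
      using part_max_pos_iff by blast
    ultimately show ?thesis by (simp only: cond_prob_def space P' UN compl_a T_def)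
  qed
  show "\<P>(l in B. ereal x < ereal g * part_min l \<bar> part_min l < \<infinity>)
      = (exp (- S x) - exp (- T)) / (1 - exp (- T))" for x
  proof -
    have "{l \<in> ?\<Lambda>. ereal x < ereal g * part_min l
        \<and> part_min l < \<infinity>} = parts_in q (?b x) - parts_in q {}"
      unfolding part_min_event[OF g, symmetric] using part_min_finite_iff by blast
    moreover have "{l \<in> ?\<Lambda>. part_min l < \<infinity>} = ?\<Lambda> - parts_in q {}"
      using part_min_finite_iff by blast
    ultimately show ?thesis by (simp only: cond_prob_def space P' UN compl_b S T_def)
  qed
qed

theorem theorem4p4:
  fixes q :: nat and M :: real and z1 z2 :: "real \<Rightarrow> real"
    and \<gamma> :: "real \<Rightarrow> real" and P :: "real \<Rightarrow> nat list measure"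
  assumes "q \<ge> 1" and "M > 0"
    and "\<forall>\<^sub>F N in at_top. calibrated q (z1 N) (z2 N) N M"
  defines "\<gamma> \<equiv> \<lambda>N. - ln (z1 N)"
    and "P \<equiv> \<lambda>N. boltzmann q (z1 N) (z2 N)"
  shows "asymp_indep_max_min P \<gamma> at_top
    \<and> (\<forall>x\<ge>0. ((\<lambda>N. \<P>(l in P N. \<gamma> N * real (part_max l) \<le> x)) \<longlongrightarrow> G_max q M x) at_top)
    \<and> (\<forall>x\<ge>0. ((\<lambda>N. \<P>(l in P N. ereal x < ereal (\<gamma> N) * part_min l)) \<longlongrightarrow> Gc_min q M x) at_top)
    \<and> (\<forall>x\<ge>0. ((\<lambda>N. \<P>(l in P N. \<gamma> N * real (part_max l) \<le> x \<bar> 0 < part_max l))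
          \<longlongrightarrow> G_max_cond q M x) at_top)
    \<and> (\<forall>x\<ge>0. ((\<lambda>N. \<P>(l in P N. ereal x < ereal (\<gamma> N) * part_min l \<bar> part_min l < \<infinity>))
          \<longlongrightarrow> Gc_min_cond q M x) at_top)"
proof -
  define T where "T N = log_partition_sum q (z1 N) (z2 N) UNIV" for N
  define S where "S x N = log_partition_sum q (z1 N) (z2 N)
      {j. - ln (z1 N) * real (Suc j ^ q) \<le> x}" for x N
  let ?G = "gamma_cdf (1 / real q)"
  have ev: "\<forall>\<^sub>F N in at_top. 0 < z1 N \<and> z1 N < 1 \<and> 0 < z2 N"
    using assms(3) by eventually_elim (simp add: calibrated_def)
  note probs = boltzmann_extreme_part_probs[OF assms(1)]
  have T: "(T \<longlongrightarrow> M) at_top"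
    unfolding T_def by (rule log_partition_sum_limits(1)[OF assms(1-3)])
  have S: "(S x \<longlongrightarrow> M * ?G x) at_top" if "0 \<le> x" for x
    unfolding S_def by (rule log_partition_sum_limits(2)[OF assms(1-3) that])
  have max_lim: "((\<lambda>N. exp (- (T N - S x N))) \<longlongrightarrow> G_max q M x) at_top" if "0 \<le> x" for x
    unfolding G_max_def using tendsto_exp[OF tendsto_minus[OF tendsto_diff[OF T S[OF that]]]]
    by (simp add: algebra_simps)
  have min_lim: "((\<lambda>N. exp (- S x N)) \<longlongrightarrow> Gc_min q M x) at_top" if "0 \<le> x" for x
    unfolding Gc_min_def using tendsto_exp[OF tendsto_minus[OF S[OF that]]] by simp
  have T_lim: "((\<lambda>N. exp (- T N)) \<longlongrightarrow> exp (- M)) at_top"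
    by (intro tendsto_intros T)
  \<comment> \<open>A nonempty partition has positive limiting probability since
    \<open>M > 0\<close>, so the conditional laws converge as quotients.\<close>
  have ne: "1 - exp (- M) \<noteq> 0" using assms(2) by simp
  show ?thesis
    unfolding asymp_indep_max_min_def
  proof (intro conjI allI impI)
    fix x y :: real assume xy: "0 \<le> y \<and> y \<le> x"
    show "((\<lambda>N. \<P>(l in P N. \<gamma> N * real (part_max l) \<le> x \<and> ereal y < ereal (\<gamma> N) * part_min l)
           - \<P>(l in P N. \<gamma> N * real (part_max l) \<le> x)
             * \<P>(l in P N. ereal y < ereal (\<gamma> N) * part_min l)) \<longlongrightarrow> 0) at_top"
    \<comment> \<open>The difference is 0 as soon as the parameters are admissible, not merely in
      the limit.\<close>
    proof (rule tendsto_eventually)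
      have "0 \<le> x" using xy by simp
      with ev xy show "\<forall>\<^sub>F N in at_top. \<P>(l in P N. \<gamma> N * real (part_max l) \<le> x
          \<and> ereal y < ereal (\<gamma> N) * part_min l)
           - \<P>(l in P N. \<gamma> N * real (part_max l) \<le> x)
             * \<P>(l in P N. ereal y < ereal (\<gamma> N) * part_min l) = 0"
        by (auto elim!: eventually_mono simp only: P_def \<gamma>_def probs diff_self)
    qed
  next
    fix x :: real assume x: "0 \<le> x"
    have "\<forall>\<^sub>F N in at_top. exp (- (T N - S x N))
        = \<P>(l in P N. \<gamma> N * real (part_max l) \<le> x)"
      using ev by eventually_elim (simp only: P_def \<gamma>_def T_def S_def probs x)
    from Lim_transform_eventually[OF max_lim[OF x] this]
    show "((\<lambda>N. \<P>(l in P N. \<gamma> N * real (part_max l) \<le> x)) \<longlongrightarrow> G_max q M x) at_top" .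
  next
    fix x :: real assume x: "0 \<le> x"
    have "\<forall>\<^sub>F N in at_top. exp (- S x N)
        = \<P>(l in P N. ereal x < ereal (\<gamma> N) * part_min l)"
      using ev by eventually_elim (simp only: P_def \<gamma>_def S_def probs)
    from Lim_transform_eventually[OF min_lim[OF x] this]
    show "((\<lambda>N. \<P>(l in P N. ereal x < ereal (\<gamma> N) * part_min l)) \<longlongrightarrow> Gc_min q M x) at_top" .
  next
    fix x :: real assume x: "0 \<le> x"
    have "\<forall>\<^sub>F N in at_top. (exp (- (T N - S x N)) - exp (- T N)) / (1 - exp (- T N))
        = \<P>(l in P N. \<gamma> N * real (part_max l) \<le> x \<bar> 0 < part_max l)"
      using ev by eventually_elim (simp only: P_def \<gamma>_def T_def S_def probs x)
    from Lim_transform_eventually[OF tendsto_divide[OF tendsto_diff[OF max_lim[OF x] T_lim]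
        tendsto_diff[OF tendsto_const T_lim] ne] this]
    show "((\<lambda>N. \<P>(l in P N. \<gamma> N * real (part_max l) \<le> x \<bar> 0 < part_max l))
          \<longlongrightarrow> G_max_cond q M x) at_top" unfolding G_max_cond_def .
  next
    fix x :: real assume x: "0 \<le> x"
    have "\<forall>\<^sub>F N in at_top. (exp (- S x N) - exp (- T N)) / (1 - exp (- T N))
        = \<P>(l in P N. ereal x < ereal (\<gamma> N) * part_min l \<bar> part_min l < \<infinity>)"
      using ev by eventually_elim (simp only: P_def \<gamma>_def T_def S_def probs)
    from Lim_transform_eventually[OF tendsto_divide[OF tendsto_diff[OF min_lim[OF x] T_lim]
        tendsto_diff[OF tendsto_const T_lim] ne] this]
    show "((\<lambda>N. \<P>(l in P N. ereal x < ereal (\<gamma> N) * part_min l \<bar> part_min l < \<infinity>))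
          \<longlongrightarrow> Gc_min_cond q M x) at_top" unfolding Gc_min_cond_def .
  qed
qed

end
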